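(* Let $F$ be a field of characteristic $0$ and let $G$ be a group. (i) If $B\colon G\to G$ is a Rota-Baxter operator on the group $G$, then $B$ extends uniquely to a Rota-Baxter operator $B\colon F[G]\to F[G]$ on the cocommutative Hopf algebra $F[G]$ (the group algebra). (ii) Conversely, if $B$ is a Rota-Baxter operator on the Hopf algebra $F[G]$, then $B(G)\subset G$ and the restriction $B|_G$ is a Rota-Baxter operator on the group $G$.
   Context: A map $B\colon G\to G$ on a group $G$ is a Rota-Baxter operator on $G$ if $B(g)B(h)=B(gB(g)hB(g)^{-1})$ for all $g,h\in G$. Sumless Sweedler notation $\Delta(x)=x_{(1)}\otimes x_{(2)}$ (and similarly for iterated comultiplications) is used. A linear map $B\colon H\to H$ of a coalgebra is a coalgebra map if $\Delta(B(x))=B(x_{(1)})\otimes B(x_{(2)})$ and $\epsilon(B(x))=\epsilon(x)$ for all $x$. If $H$ is a cocommutative Hopf algebra with antipode $S$, a Rota-Baxter operator on the Hopf algebra $H$ is a coalgebra map $B\colon H\to H$ such that $B(x)B(y)=B\big(x_{(1)}B(x_{(2)})\,y\,S(B(x_{(3)}))\big)$ for all $x,y\in H$. The group algebra $F[G]$ has its usual Hopf structure: $\Delta(g)=g\otimes g$, $\epsilon(g)=1$, $S(g)=g^{-1}$ for $g\in G$. *)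

theory Defs
  imports Complex_Main "HOL-Library.Poly_Mapping"
begin

section \<open>Free vector spaces\<close>

text \<open>The finitely supported functions \<^typ>\<open>'x \<Rightarrow>\<^sub>0 'f\<close> are the free \<open>'f\<close>-vector space on the type
  \<open>'x\<close>, with basis \<open>Poly_Mapping.single x 1\<close>.\<close>

definition fscale :: "'f::field \<Rightarrow> ('x \<Rightarrow>\<^sub>0 'f) \<Rightarrow> ('x \<Rightarrow>\<^sub>0 'f)"
  where "fscale c t = Poly_Mapping.map (\<lambda>a. c * a) t"

definition lin_ext :: "('f::field \<Rightarrow> 'v::ab_group_add \<Rightarrow> 'v) \<Rightarrow> ('x \<Rightarrow> 'v) \<Rightarrow> ('x \<Rightarrow>\<^sub>0 'f) \<Rightarrow> 'v"
  where "lin_ext s f t = (\<Sum>x\<in>Poly_Mapping.keys t. s (Poly_Mapping.lookup t x) (f x))"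

abbreviation basis :: "'x \<Rightarrow> ('x \<Rightarrow>\<^sub>0 'f::field)"
  where "basis x \<equiv> Poly_Mapping.single x 1"

lemma lookup_fscale [simp]: "Poly_Mapping.lookup (fscale c t) x = c * Poly_Mapping.lookup t x"
  by (simp add: fscale_def Poly_Mapping.map.rep_eq when_def)

global_interpretation free: vector_space fscale
  by unfold_locales (auto intro!: poly_mapping_eqI simp: lookup_add algebra_simps)

lemma fscale_single [simp]: "fscale c (Poly_Mapping.single x a) = Poly_Mapping.single x (c * a)"
  by (rule poly_mapping_eqI) (auto simp: lookup_single when_def)

lemma poly_mapping_additive_induct:
  assumes "P 0" "\<And>x c. P (Poly_Mapping.single x c)" "\<And>s t. P s \<Longrightarrow> P t \<Longrightarrow> P (s + t)"
  shows "P (t :: 'x \<Rightarrow>\<^sub>0 'f::field)"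
proof -
  have *: "P (\<Sum>x\<in>A. Poly_Mapping.single x (g x))" if "finite A" for A and g :: "'x \<Rightarrow> 'f"
    using that by induction (auto intro: assms)
  have "t = (\<Sum>x\<in>Poly_Mapping.keys t. Poly_Mapping.single x (Poly_Mapping.lookup t x))"
    by (rule poly_mapping_eqI)
      (auto simp: lookup_sum lookup_single when_def sum.delta in_keys_iff)
  with *[of "Poly_Mapping.keys t" "Poly_Mapping.lookup t"] show ?thesis by simp
qed

context vector_space
begin

lemma lin_ext_superset:
  assumes "finite A" "Poly_Mapping.keys t \<subseteq> A"
  shows "lin_ext scale f t = (\<Sum>x\<in>A. scale (Poly_Mapping.lookup t x) (f x))"
  unfolding lin_ext_def using assms
  by (intro sum.mono_neutral_left) (auto simp: in_keys_iff)

lemma lin_ext_zero [simp]: "lin_ext scale f 0 = 0"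
  by (simp add: lin_ext_def)

lemma lin_ext_single [simp]: "lin_ext scale f (Poly_Mapping.single x c) = scale c (f x)"
  by (simp add: lin_ext_def)

lemma lin_ext_add [simp]: "lin_ext scale f (s + t) = lin_ext scale f s + lin_ext scale f t"
proof -
  let ?A = "Poly_Mapping.keys s \<union> Poly_Mapping.keys t"
  have "Poly_Mapping.keys (s + t) \<subseteq> ?A" by (rule Poly_Mapping.keys_add)
  then show ?thesis
    by (simp add: lin_ext_superset[of ?A] lookup_add scale_left_distrib sum.distrib)
qed

lemma lin_ext_fscale [simp]: "lin_ext scale f (fscale c t) = scale c (lin_ext scale f t)"
  by (induction t rule: poly_mapping_additive_induct)
    (auto simp: scale_right_distrib free.scale_right_distrib)

end

lemma vector_space_mult: "vector_space ((*) :: 'f::field \<Rightarrow> 'f \<Rightarrow> 'f)"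
  by unfold_locales (auto simp: algebra_simps)

section \<open>Tensor products\<close>

text \<open>The tensor product of two vector spaces is the free vector space on the set of pairs modulo
  the subspace spanned by the bilinearity relations. Elements of the tensor product are handled
  through their representatives in the free space; \<open>tensor_eq\<close> is equality of the represented
  tensors. The threefold tensor product is presented in the same way by triples.\<close>

definition tensor_rels :: "('f::field \<Rightarrow> 'v::ab_group_add \<Rightarrow> 'v) \<Rightarrow> ('v \<times> 'v \<Rightarrow>\<^sub>0 'f) set" where
  "tensor_rels s =
     {basis (a + a', b) - basis (a, b) - basis (a', b) |a a' b. True} \<union>
     {basis (a, b + b') - basis (a, b) - basis (a, b') |a b b'. True} \<union>
     {basis (s c a, b) - fscale c (basis (a, b)) |c a b. True} \<union>
     {basis (a, s c b) - fscale c (basis (a, b)) |c a b. True}"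

definition tensor_eq ::
    "('f::field \<Rightarrow> 'v::ab_group_add \<Rightarrow> 'v) \<Rightarrow> ('v \<times> 'v \<Rightarrow>\<^sub>0 'f) \<Rightarrow> ('v \<times> 'v \<Rightarrow>\<^sub>0 'f) \<Rightarrow> bool" where
  "tensor_eq s t u \<longleftrightarrow> t - u \<in> free.span (tensor_rels s)"

definition tensor3_rels ::
    "('f::field \<Rightarrow> 'v::ab_group_add \<Rightarrow> 'v) \<Rightarrow> ('v \<times> 'v \<times> 'v \<Rightarrow>\<^sub>0 'f) set" where
  "tensor3_rels s =
     {basis (a + a', b, c) - basis (a, b, c) - basis (a', b, c) |a a' b c. True} \<union>
     {basis (a, b + b', c) - basis (a, b, c) - basis (a, b', c) |a b b' c. True} \<union>
     {basis (a, b, c + c') - basis (a, b, c) - basis (a, b, c') |a b c c'. True} \<union>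
     {basis (s k a, b, c) - fscale k (basis (a, b, c)) |k a b c. True} \<union>
     {basis (a, s k b, c) - fscale k (basis (a, b, c)) |k a b c. True} \<union>
     {basis (a, b, s k c) - fscale k (basis (a, b, c)) |k a b c. True}"

definition tensor3_eq ::
    "('f::field \<Rightarrow> 'v::ab_group_add \<Rightarrow> 'v) \<Rightarrow> ('v \<times> 'v \<times> 'v \<Rightarrow>\<^sub>0 'f) \<Rightarrow> ('v \<times> 'v \<times> 'v \<Rightarrow>\<^sub>0 'f) \<Rightarrow> bool"
  where "tensor3_eq s t u \<longleftrightarrow> t - u \<in> free.span (tensor3_rels s)"

definition tensor_map ::
    "('v \<Rightarrow> 'v) \<Rightarrow> ('v \<Rightarrow> 'v) \<Rightarrow> ('v \<times> 'v \<Rightarrow>\<^sub>0 'f::field) \<Rightarrow> ('v \<times> 'v \<Rightarrow>\<^sub>0 'f)" where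
  "tensor_map f g = lin_ext fscale (\<lambda>(a, b). basis (f a, g b))"

definition tensor_swap :: "('v \<times> 'v \<Rightarrow>\<^sub>0 'f::field) \<Rightarrow> ('v \<times> 'v \<Rightarrow>\<^sub>0 'f)" where
  "tensor_swap = lin_ext fscale (\<lambda>(a, b). basis (b, a))"

definition tensor_mult ::
    "('v::times \<times> 'v \<Rightarrow>\<^sub>0 'f::field) \<Rightarrow> ('v \<times> 'v \<Rightarrow>\<^sub>0 'f) \<Rightarrow> ('v \<times> 'v \<Rightarrow>\<^sub>0 'f)" where
  "tensor_mult t u =
     lin_ext fscale (\<lambda>(a, b). lin_ext fscale (\<lambda>(c, d). basis (a * c, b * d)) u) t"

lemma tensor_eq_refl [simp]: "tensor_eq s t t"
  by (simp add: tensor_eq_def free.span_zero)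

lemma tensor3_eq_refl [simp]: "tensor3_eq s t t"
  by (simp add: tensor3_eq_def free.span_zero)

section \<open>Coalgebras and Hopf algebras\<close>

text \<open>\<open>comul\<close> yields a representative of \<open>\<Delta>(x)\<close>, so its axioms are stated up to \<^const>\<open>tensor_eq\<close>.
  \<open>comul_left\<close> and \<open>comul_right\<close> represent \<open>(\<Delta> \<otimes> id)(\<Delta>(x))\<close> and \<open>(id \<otimes> \<Delta>)(\<Delta>(x))\<close>.\<close>

definition comul_left ::
    "('v \<Rightarrow> ('v \<times> 'v \<Rightarrow>\<^sub>0 'f::field)) \<Rightarrow> 'v \<Rightarrow> ('v \<times> 'v \<times> 'v \<Rightarrow>\<^sub>0 'f)" where
  "comul_left \<Delta> x =
     lin_ext fscale (\<lambda>(a, b). lin_ext fscale (\<lambda>(c, d). basis (c, d, b)) (\<Delta> a)) (\<Delta> x)"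

definition comul_right ::
    "('v \<Rightarrow> ('v \<times> 'v \<Rightarrow>\<^sub>0 'f::field)) \<Rightarrow> 'v \<Rightarrow> ('v \<times> 'v \<times> 'v \<Rightarrow>\<^sub>0 'f)" where
  "comul_right \<Delta> x =
     lin_ext fscale (\<lambda>(a, b). lin_ext fscale (\<lambda>(c, d). basis (a, c, d)) (\<Delta> b)) (\<Delta> x)"

locale coalgebra = vector_space scale
  for scale :: "'f::field \<Rightarrow> 'h::ab_group_add \<Rightarrow> 'h" +
  fixes comul :: "'h \<Rightarrow> ('h \<times> 'h \<Rightarrow>\<^sub>0 'f)"
    and counit :: "'h \<Rightarrow> 'f"
  assumes comul_add: "tensor_eq scale (comul (x + y)) (comul x + comul y)"
    and comul_scale: "tensor_eq scale (comul (scale c x)) (fscale c (comul x))"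
    and linear_counit: "Vector_Spaces.linear scale (*) counit"
    and coassoc: "tensor3_eq scale (comul_left comul x) (comul_right comul x)"
    and counit_left: "lin_ext scale (\<lambda>(a, b). scale (counit a) b) (comul x) = x"
    and counit_right: "lin_ext scale (\<lambda>(a, b). scale (counit b) a) (comul x) = x"
begin

definition coalgebra_map :: "('h \<Rightarrow> 'h) \<Rightarrow> bool" where
  "coalgebra_map B \<longleftrightarrow>
     Vector_Spaces.linear scale scale B \<and>
     (\<forall>x. tensor_eq scale (comul (B x)) (tensor_map B B (comul x))) \<and>
     (\<forall>x. counit (B x) = counit x)"

end

locale hopf_algebra = coalgebra scale comul counit
  for scale :: "'f::field \<Rightarrow> 'h::ring_1 \<Rightarrow> 'h"
    and comul :: "'h \<Rightarrow> ('h \<times> 'h \<Rightarrow>\<^sub>0 'f)"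
    and counit :: "'h \<Rightarrow> 'f" +
  fixes antipode :: "'h \<Rightarrow> 'h"
  assumes mult_scale_left: "scale c x * y = scale c (x * y)"
    and mult_scale_right: "x * scale c y = scale c (x * y)"
    and comul_one: "tensor_eq scale (comul 1) (basis (1, 1))"
    and comul_mult: "tensor_eq scale (comul (x * y)) (tensor_mult (comul x) (comul y))"
    and counit_one: "counit 1 = 1"
    and counit_mult: "counit (x * y) = counit x * counit y"
    and linear_antipode: "Vector_Spaces.linear scale scale antipode"
    and antipode_left: "lin_ext scale (\<lambda>(a, b). antipode a * b) (comul x) = scale (counit x) 1"
    and antipode_right: "lin_ext scale (\<lambda>(a, b). a * antipode b) (comul x) = scale (counit x) 1"

locale cocommutative_hopf_algebra = hopf_algebra scale comul counit antipode
  for scale :: "'f::field \<Rightarrow> 'h::ring_1 \<Rightarrow> 'h"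
    and comul :: "'h \<Rightarrow> ('h \<times> 'h \<Rightarrow>\<^sub>0 'f)"
    and counit :: "'h \<Rightarrow> 'f"
    and antipode :: "'h \<Rightarrow> 'h" +
  assumes cocommutative: "tensor_eq scale (tensor_swap (comul x)) (comul x)"
begin

text \<open>\<open>lin_ext scale\<close> evaluates the map \<open>(x1, x2, x3) \<mapsto> x1 * B x2 * y * S (B x3)\<close> on a representative
  of \<open>x\<^sub>(\<^sub>1\<^sub>) \<otimes> x\<^sub>(\<^sub>2\<^sub>) \<otimes> x\<^sub>(\<^sub>3\<^sub>)\<close>. For linear \<open>B\<close>, ensured by \<open>coalgebra_map\<close>, this map is trilinear,
  so the value does not depend on the representative.\<close>

definition rota_baxter :: "('h \<Rightarrow> 'h) \<Rightarrow> bool" where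
  "rota_baxter B \<longleftrightarrow>
     coalgebra_map B \<and>
     (\<forall>x y. B x * B y =
        B (lin_ext scale (\<lambda>(x1, x2, x3). x1 * B x2 * y * antipode (B x3)) (comul_left comul x)))"

end

section \<open>The group algebra\<close>

text \<open>Groups are types of class \<^class>\<open>group_add\<close>, which does not assume commutativity: the group
  operation is written \<open>+\<close>, the inverse of \<open>g\<close> is \<open>- g\<close>. With this convention
  \<^typ>\<open>'g \<Rightarrow>\<^sub>0 'f\<close> carries the convolution product, that is, it is the group algebra, and the group
  element \<open>g\<close> is the basis vector \<^term>\<open>basis g\<close>.\<close>

definition group_rota_baxter :: "('g::group_add \<Rightarrow> 'g) \<Rightarrow> bool" where
  "group_rota_baxter B \<longleftrightarrow> (\<forall>g h. B g + B h = B (g + B g + h + (- B g)))"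

definition ga_comul ::
    "('g \<Rightarrow>\<^sub>0 'f::field) \<Rightarrow> (('g \<Rightarrow>\<^sub>0 'f) \<times> ('g \<Rightarrow>\<^sub>0 'f) \<Rightarrow>\<^sub>0 'f)" where
  "ga_comul = lin_ext fscale (\<lambda>g. basis (basis g, basis g))"

definition ga_counit :: "('g \<Rightarrow>\<^sub>0 'f::field) \<Rightarrow> 'f" where
  "ga_counit = lin_ext (*) (\<lambda>g. 1)"

definition ga_antipode :: "('g::group_add \<Rightarrow>\<^sub>0 'f::field) \<Rightarrow> ('g \<Rightarrow>\<^sub>0 'f)" where
  "ga_antipode = lin_ext fscale (\<lambda>g. basis (- g))"

lemma ga_comul_simps [simp]:
  "ga_comul 0 = 0"
  "ga_comul (x + y) = ga_comul x + ga_comul y"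
  "ga_comul (fscale c x) = fscale c (ga_comul x)"
  "ga_comul (Poly_Mapping.single g c) = Poly_Mapping.single (basis g, basis g) c"
  by (simp_all add: ga_comul_def)

lemma ga_counit_simps [simp]:
  "ga_counit 0 = 0"
  "ga_counit (x + y) = ga_counit x + ga_counit y"
  "ga_counit (fscale c x) = c * ga_counit x"
  "ga_counit (Poly_Mapping.single g c) = c"
  by (simp_all add: ga_counit_def vector_space.lin_ext_zero[OF vector_space_mult]
      vector_space.lin_ext_add[OF vector_space_mult]
      vector_space.lin_ext_fscale[OF vector_space_mult]
      vector_space.lin_ext_single[OF vector_space_mult])

lemma ga_antipode_simps [simp]:
  "ga_antipode 0 = 0"
  "ga_antipode (x + y) = ga_antipode x + ga_antipode y"
  "ga_antipode (fscale c x) = fscale c (ga_antipode x)"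
  "ga_antipode (Poly_Mapping.single g c) = Poly_Mapping.single (- g) c"
  by (simp_all add: ga_antipode_def)

lemma fscale_mult_left: "fscale c x * y = fscale c (x * (y :: 'g::monoid_add \<Rightarrow>\<^sub>0 'f::field))"
proof (induction x rule: poly_mapping_additive_induct)
  case (2 g a)
  show ?case
    by (induction y rule: poly_mapping_additive_induct)
      (auto simp: mult_single distrib_left free.scale_right_distrib mult.assoc)
qed (auto simp: distrib_right free.scale_right_distrib)

lemma fscale_mult_right: "x * fscale c y = fscale c (x * (y :: 'g::monoid_add \<Rightarrow>\<^sub>0 'f::field))"
proof (induction x rule: poly_mapping_additive_induct)
  case (2 g a)
  show ?case
    by (induction y rule: poly_mapping_additive_induct)
      (auto simp: mult_single distrib_left free.scale_right_distrib mult.left_commute)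
qed (auto simp: distrib_right free.scale_right_distrib)

lemma ga_comul_mult:
  "ga_comul (x * y) = tensor_mult (ga_comul x) (ga_comul (y :: 'g::monoid_add \<Rightarrow>\<^sub>0 'f::field))"
proof (induction x rule: poly_mapping_additive_induct)
  case (2 g a)
  show ?case
    by (induction y rule: poly_mapping_additive_induct)
      (auto simp: tensor_mult_def mult_single distrib_left free.scale_right_distrib)
qed (auto simp: tensor_mult_def distrib_right)

lemma ga_counit_mult:
  "ga_counit (x * y) = ga_counit x * ga_counit (y :: 'g::monoid_add \<Rightarrow>\<^sub>0 'f::field)"
proof (induction x rule: poly_mapping_additive_induct)
  case (2 g a)
  show ?case
    by (induction y rule: poly_mapping_additive_induct)
      (auto simp: mult_single distrib_left)
qed (auto simp: distrib_right)

lemma one_eq_basis: "(1 :: 'g::monoid_add \<Rightarrow>\<^sub>0 'f::field) = basis 0"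
  by (simp add: single_one)

lemma linear_ga_counit: "Vector_Spaces.linear fscale (*) ga_counit"
  unfolding Vector_Spaces.linear_iff
  by (auto simp: vector_space_mult free.vector_space_axioms)

lemma linear_ga_antipode: "Vector_Spaces.linear fscale fscale ga_antipode"
  unfolding Vector_Spaces.linear_iff
  by (auto simp: free.vector_space_axioms)

lemma comul_left_add:
  "comul_left ga_comul (x + y) = comul_left ga_comul x + comul_left ga_comul y"
  by (simp add: comul_left_def)

lemma comul_right_add:
  "comul_right ga_comul (x + y) = comul_right ga_comul x + comul_right ga_comul y"
  by (simp add: comul_right_def)

lemma ga_coassoc: "comul_left ga_comul x = comul_right ga_comul x"
  by (induction x rule: poly_mapping_additive_induct)
    (simp_all add: comul_left_add comul_right_add, simp_all add: comul_left_def comul_right_def)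

global_interpretation group_algebra: cocommutative_hopf_algebra
  "fscale :: 'f::field \<Rightarrow> ('g::group_add \<Rightarrow>\<^sub>0 'f) \<Rightarrow> ('g \<Rightarrow>\<^sub>0 'f)" ga_comul ga_counit ga_antipode
proof (intro cocommutative_hopf_algebra.intro hopf_algebra.intro coalgebra.intro
    coalgebra_axioms.intro hopf_algebra_axioms.intro cocommutative_hopf_algebra_axioms.intro
    free.vector_space_axioms linear_ga_counit linear_ga_antipode)
  fix x y :: "'g \<Rightarrow>\<^sub>0 'f" and c :: 'f
  show "tensor_eq fscale (ga_comul (x + y)) (ga_comul x + ga_comul y)"
    and "tensor_eq fscale (ga_comul (fscale c x)) (fscale c (ga_comul x))"
    and "tensor_eq fscale (ga_comul (1 :: 'g \<Rightarrow>\<^sub>0 'f)) (basis (1, 1))"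
    and "tensor_eq fscale (ga_comul (x * y)) (tensor_mult (ga_comul x) (ga_comul y))"
    and "tensor3_eq fscale (comul_left ga_comul x) (comul_right ga_comul x)"
    and "ga_counit (1 :: 'g \<Rightarrow>\<^sub>0 'f) = 1"
    and "ga_counit (x * y) = ga_counit x * ga_counit y"
    and "fscale c x * y = fscale c (x * y)"
    and "x * fscale c y = fscale c (x * y)"
    by (simp_all add: ga_comul_mult ga_counit_mult ga_coassoc one_eq_basis
        fscale_mult_left fscale_mult_right del: single_one)
  show "lin_ext fscale (\<lambda>(a, b). fscale (ga_counit a) b) (ga_comul x) = x"
    by (induction x rule: poly_mapping_additive_induct) simp_all
  show "lin_ext fscale (\<lambda>(a, b). fscale (ga_counit b) a) (ga_comul x) = x"
    by (induction x rule: poly_mapping_additive_induct) simp_all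
  show "lin_ext fscale (\<lambda>(a, b). ga_antipode a * b) (ga_comul x) = fscale (ga_counit x) 1"
    by (induction x rule: poly_mapping_additive_induct)
      (simp_all add: mult_single one_eq_basis single_add del: single_one)
  show "lin_ext fscale (\<lambda>(a, b). a * ga_antipode b) (ga_comul x) = fscale (ga_counit x) 1"
    by (induction x rule: poly_mapping_additive_induct)
      (simp_all add: mult_single one_eq_basis single_add del: single_one)
  have "tensor_swap (ga_comul x) = ga_comul x"
    by (induction x rule: poly_mapping_additive_induct) (simp_all add: tensor_swap_def)
  then show "tensor_eq fscale (tensor_swap (ga_comul x)) (ga_comul x)"
    by simp
qed

end

theory Submission
  imports Defs
begin

text \<open>For group-like \<open>x\<close>, evaluating \<open>\<Delta>(x) = x \<otimes> x\<close> at pairs of coordinate functionals shows that the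
  coefficients of \<open>x\<close> are pairwise orthogonal idempotents of the field; since \<open>\<epsilon>(x) = 1\<close>, exactly
  one of them is \<open>1\<close> and \<open>x\<close> is a group element. Coalgebra maps preserve group-like elements, hence
  map \<open>G\<close> to \<open>G\<close>, and on group elements the Hopf identity is the group identity.\<close>

lemma (in vector_space) lin_ext_diff:
  "lin_ext scale f (s - t) = lin_ext scale f s - lin_ext scale f t"
  using lin_ext_add[of f "s - t" t] by simp

text \<open>Universal property of the tensor product: the linear extension of a bilinear
  \<open>f\<close> kills every relation in \<open>tensor_rels\<close>, hence their span. It turns
  equality up to \<open>tensor_eq\<close> into equality of values in \<open>'b\<close>, or in the
  field when \<open>f\<close> is a product of functionals.\<close>

lemma (in vector_space) tensor_eq_lin_ext_cong:
  fixes s :: "'a \<Rightarrow> 'v::ab_group_add \<Rightarrow> 'v"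
  assumes "tensor_eq s t u"
    and "\<And>a a' b. f (a + a', b) = f (a, b) + f (a', b)"
    and "\<And>a b b'. f (a, b + b') = f (a, b) + f (a, b')"
    and "\<And>c a b. f (s c a, b) = scale c (f (a, b))"
    and "\<And>c a b. f (a, s c b) = scale c (f (a, b))"
  shows "lin_ext scale f t = lin_ext scale f u"
proof -
  have "free.subspace {r. lin_ext scale f r = 0}"
    by (auto simp: free.subspace_def)
  moreover have "tensor_rels s \<subseteq> {r. lin_ext scale f r = 0}"
    using assms(2-) by (auto simp: tensor_rels_def lin_ext_diff simp del: fscale_single)
  ultimately have "t - u \<in> {r. lin_ext scale f r = 0}"
    using assms(1) free.span_minimal unfolding tensor_eq_def by blast
  then show ?thesis by (simp add: lin_ext_diff)
qed

text \<open>Dually, the coordinate functionals at \<open>a\<close> and \<open>b\<close> multiply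
  like indicator functions of points: their product is zero unless \<open>a = b\<close>, and
  idempotent otherwise.\<close>

lemma lin_ext_lookup_comul:
  fixes x :: "'g \<Rightarrow>\<^sub>0 'f::field"
  shows "lin_ext (*) (\<lambda>(u, v). Poly_Mapping.lookup u a * Poly_Mapping.lookup v b) (ga_comul x) =
     (Poly_Mapping.lookup x a when a = b)"
proof -
  interpret field: vector_space "(*) :: 'f \<Rightarrow> 'f \<Rightarrow> 'f" by (rule vector_space_mult)
  show ?thesis
    by (induction x rule: poly_mapping_additive_induct)
      (auto simp: lookup_single lookup_add when_def)
qed

lemma grouplike_imp_basis:
  fixes x :: "'g \<Rightarrow>\<^sub>0 'f::field"
  assumes "tensor_eq fscale (ga_comul x) (basis (x, x))" and "ga_counit x = 1"
  shows "x \<in> range basis"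
proof -
  have coeff: "(Poly_Mapping.lookup x a when a = b) =
      Poly_Mapping.lookup x a * Poly_Mapping.lookup x b" for a b
  proof -
    let ?f = "\<lambda>(u, v). Poly_Mapping.lookup u a * Poly_Mapping.lookup v b :: 'f"
    have "lin_ext (*) ?f (ga_comul x) = lin_ext (*) ?f (basis (x, x))"
      by (rule vector_space.tensor_eq_lin_ext_cong[OF vector_space_mult assms(1)])
        (auto simp: lookup_add algebra_simps)
    then show ?thesis
      by (simp add: lin_ext_lookup_comul vector_space.lin_ext_single[OF vector_space_mult])
  qed
  \<comment> \<open>The counit condition enters only here, to exclude the zero vector.\<close>
  have "x \<noteq> 0" using assms(2) by auto
  then obtain a where a: "Poly_Mapping.lookup x a \<noteq> 0"
    by (metis lookup_zero poly_mapping_eqI)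
  \<comment> \<open>The nonzero coefficient at \<open>a\<close> can be cancelled in
    \<open>coeff\<close>: the case \<open>b = a\<close> makes it 1, and every other \<open>b\<close>
    gets coefficient 0.\<close>
  have "Poly_Mapping.lookup x b = (1 when a = b)" for b
    using a coeff[of a b] by (auto simp: when_def split: if_splits)
  then have "x = basis a"
    by (intro poly_mapping_eqI) (simp add: lookup_single)
  then show ?thesis by blast
qed

text \<open>This yields uniqueness of the extension: a linear map on a free space is determined by
  its values on the basis.\<close>

lemma (in vector_space) linear_eq_lin_ext:
  assumes "Vector_Spaces.linear fscale scale T"
  shows "T x = lin_ext scale (\<lambda>g. T (basis g)) x"
proof (induction x rule: poly_mapping_additive_induct)
  case (2 g c)
  have "T (fscale c (basis g)) = scale c (T (basis g))"
    using assms by (simp only: Vector_Spaces.linear_iff)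
  then show ?case by simp
next
  case 1
  have "T (fscale 0 0) = scale 0 (T 0)"
    using assms by (simp only: Vector_Spaces.linear_iff)
  then show ?case by simp
qed (use assms in \<open>simp add: Vector_Spaces.linear_iff\<close>)

lemma comul_left_single [simp]:
  "comul_left ga_comul (Poly_Mapping.single g c) =
     Poly_Mapping.single (basis g, basis g, basis g) c"
  by (simp add: comul_left_def)

lemma rota_baxter_linear:
  "group_algebra.rota_baxter T \<Longrightarrow> Vector_Spaces.linear fscale fscale T"
  by (simp add: group_algebra.rota_baxter_def group_algebra.coalgebra_map_def)

text \<open>Both sides of the Hopf identity are linear in \<open>x\<close> and in \<open>y\<close>,
  so it suffices to check basis vectors, where it becomes the group identity.\<close>

lemma rota_baxter_lin_ext:
  fixes B :: "'g::group_add \<Rightarrow> 'g"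
  assumes "group_rota_baxter B"
  shows "group_algebra.rota_baxter (lin_ext fscale (\<lambda>g. basis (B g)) :: ('g \<Rightarrow>\<^sub>0 'f::field) \<Rightarrow> _)"
proof -
  let ?B = "lin_ext fscale (\<lambda>g. basis (B g)) :: ('g \<Rightarrow>\<^sub>0 'f) \<Rightarrow> _"
  have linear: "Vector_Spaces.linear fscale fscale ?B"
    by (simp add: Vector_Spaces.linear_iff free.vector_space_axioms)
  have comul: "ga_comul (?B x) = tensor_map ?B ?B (ga_comul x)" for x
    by (induction x rule: poly_mapping_additive_induct) (simp_all add: tensor_map_def)
  have counit: "ga_counit (?B x) = ga_counit x" for x
    by (induction x rule: poly_mapping_additive_induct) simp_all
  \<comment> \<open>The argument of the outer \<open>?B\<close>, as a linear function of a threefold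
    tensor, so that scalars and sums in \<open>x\<close> pass through it.\<close>
  let ?E = "\<lambda>y. lin_ext fscale (\<lambda>(x1, x2, x3). x1 * ?B x2 * y * ga_antipode (?B x3))"
  have basis: "?B (basis g) * ?B y = ?B (?E y (basis (basis g, basis g, basis g)))" for g y
  proof (induction y rule: poly_mapping_additive_induct)
    case (2 h c)
    show ?case using assms by (simp add: mult_single group_rota_baxter_def)
  qed (simp_all add: distrib_left distrib_right)
  have rb: "?B x * ?B y = ?B (?E y (comul_left ga_comul x))" for x y
  proof (induction x rule: poly_mapping_additive_induct)
    case (2 g c)
    \<comment> \<open>Writing \<open>single g c\<close> as a scalar multiple of
      \<open>basis g\<close> lets \<open>c\<close> be pulled out of both sides, leaving the case of
      a basis vector.\<close>
    have "?B (fscale c (basis g)) * ?B y =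
        ?B (?E y (fscale c (basis (basis g, basis g, basis g))))"
      unfolding free.lin_ext_fscale fscale_mult_left basis ..
    then show ?case by simp
  qed (simp_all add: comul_left_add distrib_right, simp add: comul_left_def)
  show ?thesis
    unfolding group_algebra.rota_baxter_def group_algebra.coalgebra_map_def
    using linear counit rb by (simp add: comul)
qed

lemma rota_baxter_basis_in_range:
  assumes "group_algebra.rota_baxter T"
  shows "T (basis g) \<in> range basis"
proof (rule grouplike_imp_basis)
  have "tensor_eq fscale (ga_comul (T (basis g))) (tensor_map T T (ga_comul (basis g)))"
    using assms by (simp only: group_algebra.rota_baxter_def group_algebra.coalgebra_map_def)
  then show "tensor_eq fscale (ga_comul (T (basis g))) (basis (T (basis g), T (basis g)))"
    by (simp add: tensor_map_def)
  have "ga_counit (T (basis g)) = ga_counit (basis g)"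
    using assms by (simp only: group_algebra.rota_baxter_def group_algebra.coalgebra_map_def)
  then show "ga_counit (T (basis g)) = 1" by simp
qed

lemma group_rota_baxter_restrict:
  fixes T :: "('g::group_add \<Rightarrow>\<^sub>0 'f::field) \<Rightarrow> ('g \<Rightarrow>\<^sub>0 'f)"
  assumes T: "group_algebra.rota_baxter T" and B: "\<And>g. T (basis g) = basis (B g)"
  shows "group_rota_baxter B"
  unfolding group_rota_baxter_def
proof (intro allI)
  fix g h
  have "T (basis g) * T (basis h) =
      T (lin_ext fscale (\<lambda>(x1, x2, x3). x1 * T x2 * basis h * ga_antipode (T x3))
          (comul_left ga_comul (basis g)))"
    using T by (simp only: group_algebra.rota_baxter_def)
  then have "basis (B g + B h) = (basis (B (g + B g + h + - B g)) :: 'g \<Rightarrow>\<^sub>0 'f)"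
    by (simp add: B mult_single)
  \<comment> \<open>A basis vector has coefficient \<open>1 \<noteq> 0\<close> at its group element,
    so its key set is a singleton that recovers this element.\<close>
  then have "Poly_Mapping.keys (basis (B g + B h) :: 'g \<Rightarrow>\<^sub>0 'f) =
      Poly_Mapping.keys (basis (B (g + B g + h + - B g)) :: 'g \<Rightarrow>\<^sub>0 'f)"
    by (rule arg_cong)
  then show "B g + B h = B (g + B g + h + - B g)" by simp
qed

theorem theorem1:
  shows
    "(\<forall>B :: 'g::group_add \<Rightarrow> 'g. group_rota_baxter B \<longrightarrow>
        (\<exists>!B' :: ('g \<Rightarrow>\<^sub>0 'f::field_char_0) \<Rightarrow> ('g \<Rightarrow>\<^sub>0 'f).
           group_algebra.rota_baxter B' \<and> (\<forall>g. B' (basis g) = basis (B g)))) \<and>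
     (\<forall>B' :: ('g \<Rightarrow>\<^sub>0 'f) \<Rightarrow> ('g \<Rightarrow>\<^sub>0 'f). group_algebra.rota_baxter B' \<longrightarrow>
        B' ` range basis \<subseteq> range basis \<and>
        (\<exists>B :: 'g \<Rightarrow> 'g. (\<forall>g. B' (basis g) = basis (B g)) \<and> group_rota_baxter B))"
proof (intro conjI allI impI)
  fix B :: "'g \<Rightarrow> 'g"
  assume B: "group_rota_baxter B"
  show "\<exists>!B' :: ('g \<Rightarrow>\<^sub>0 'f) \<Rightarrow> ('g \<Rightarrow>\<^sub>0 'f).
      group_algebra.rota_baxter B' \<and> (\<forall>g. B' (basis g) = basis (B g))"
  proof (rule ex1I)
    show "group_algebra.rota_baxter (lin_ext fscale (\<lambda>g. basis (B g)) :: ('g \<Rightarrow>\<^sub>0 'f) \<Rightarrow> _) \<and>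
        (\<forall>g. lin_ext fscale (\<lambda>g. basis (B g)) (basis g :: 'g \<Rightarrow>\<^sub>0 'f) = (basis (B g) :: 'g \<Rightarrow>\<^sub>0 'f))"
      using rota_baxter_lin_ext[OF B] by simp
  next
    fix T :: "('g \<Rightarrow>\<^sub>0 'f) \<Rightarrow> ('g \<Rightarrow>\<^sub>0 'f)"
    assume T: "group_algebra.rota_baxter T \<and> (\<forall>g. T (basis g) = basis (B g))"
    \<comment> \<open>Linearity is part of being a coalgebra map, so the prescribed values on the
      basis fix \<open>T\<close>.\<close>
    show "T = lin_ext fscale (\<lambda>g. basis (B g))"
    proof
      fix x
      have "T x = lin_ext fscale (\<lambda>g. T (basis g)) x"
        using T by (intro free.linear_eq_lin_ext rota_baxter_linear) simp
      then show "T x = lin_ext fscale (\<lambda>g. basis (B g)) x"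
        using T by simp
    qed
  qed
next
  fix T :: "('g \<Rightarrow>\<^sub>0 'f) \<Rightarrow> ('g \<Rightarrow>\<^sub>0 'f)"
  assume T: "group_algebra.rota_baxter T"
  show "T ` range basis \<subseteq> range basis"
    using rota_baxter_basis_in_range[OF T] by blast
  have "\<exists>h. T (basis g) = basis h" for g
    using rota_baxter_basis_in_range[OF T] by blast
  then obtain B where "\<And>g. T (basis g) = basis (B g)" by metis
  then show "\<exists>B. (\<forall>g. T (basis g) = basis (B g)) \<and> group_rota_baxter B"
    using group_rota_baxter_restrict[OF T] by blast
qed

end
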